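(* Assume: (i) $\mathbf\Theta$ is totally bounded; (ii) $\mathbb{E}_{(\mathbf x,y)\sim\mathbf\Pi}[|\mathbf x|^\alpha]<\infty$; (iii) $\sup_{\theta\in\mathbf\Theta}R_{\ell_\alpha}(\theta)<\infty$, where $R_{\ell_\alpha}(\theta)=\mathbb{E}_{(\mathbf x,y)\sim\mathbf\Pi}[|y-\mathbf x^T\theta|^\alpha]$; (iv) there is a constant $r>0$ such that $|\theta|\le r$ for all $\theta\in\mathbf\Theta\subseteq\mathbb{R}^d$. Let $\delta\in(0,\frac12)$ and $\beta=\Big(\frac1n\log\frac{N(\mathbf\Theta,1/n)}{\delta^2}\Big)^{1/\alpha}$. Let $\theta^*$ be a minimizer over $\mathbf\Theta$ of $R_{\ell_1}(\theta)=\mathbb{E}_{(\mathbf x,y)\sim\mathbf\Pi}\big[|\mathbf x^T\theta-y|\big]$ and let $\hat\theta$ be a minimizer over $\mathbf\Theta$ of $\widehat R_{\varphi,\ell_1}(\theta)=\frac1{n\beta}\sum_{i=1}^n\varphi\big(\beta|y_i-\mathbf x_i^T\theta|\big)$. Then, with probability at least $1-2\delta$, $$R_{\ell_1}(\hat\theta)-R_{\ell_1}(\theta^* )\le\frac2n\mathbb{E}|\mathbf x_1|+\Big(\frac{2^{\alpha-1}}{\alpha n^\alpha}\mathbb{E}|\mathbf x_1|^\alpha+\frac{2^{\alpha-1}+1}{\alpha}\sup_{\theta\in\mathbf\Theta}R_{\ell_\alpha}(\theta)+1\Big)\Big(\frac1n\big(d\log(6nr)+\log\tfrac1{\delta^2}\big)\Big)^{\frac{\alpha-1}{\alpha}},$$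 and the right-hand side is $O\Big(\big(\frac{d\log n}{n}\big)^{\frac{\alpha-1}{\alpha}}\Big)$ as $n\to\infty$ (all other quantities being fixed).
   Context: Let $\alpha\in(1,2)$, $\mathbf\Theta\subseteq\mathbb{R}^d$ with the Euclidean metric ($|\cdot|$ denotes the Euclidean norm), and let $\mathbf\Pi$ be a probability distribution on $\mathbb{R}^d\times\mathbb{R}$. Let $(\mathbf x_1,y_1),\dots,(\mathbf x_n,y_n)$ be i.i.d. samples from $\mathbf\Pi$. Here $R_{\ell_1}(\hat\theta)$ means the function $R_{\ell_1}$ evaluated at the (sample-dependent) point $\hat\theta$. The minimizers are assumed to exist. Let $\varphi:\mathbb{R}\to\mathbb{R}$ be non-decreasing with $-\log\big(1-x+\frac{|x|^\alpha}{\alpha}\big)\le\varphi(x)\le\log\big(1+x+\frac{|x|^\alpha}{\alpha}\big)$ for all $x\in\mathbb{R}$. An $\varepsilon$-net of $\mathbf\Theta$ is a subset $\mathcal N\subseteq\mathbf\Theta$ such that every $\theta\in\mathbf\Theta$ has some $\tilde\theta\in\mathcal N$ with $|\theta-\tilde\theta|\le\varepsilon$. The covering number $N(\mathbf\Theta,\varepsilon)$ is the minimal cardinality of an $\varepsilon$-net of $\mathbf\Theta$; $\mathbf\Theta$ is totally bounded if a finite $\varepsilon$-net exists for every $\varepsilon>0$. *)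

theory Defs
  imports "HOL-Probability.Probability" "HOL-Library.Landau_Symbols"
begin

definition eps_net :: "'a::metric_space set \<Rightarrow> real \<Rightarrow> 'a set \<Rightarrow> bool" where
  "eps_net \<Theta> \<epsilon> \<N> \<longleftrightarrow> \<N> \<subseteq> \<Theta> \<and> (\<forall>\<theta>\<in>\<Theta>. \<exists>\<theta>'\<in>\<N>. dist \<theta> \<theta>' \<le> \<epsilon>)"

text \<open>
  Only finite nets are counted, because \<open>card\<close> of an infinite set is \<open>0\<close>. The value is
  meaningful when a finite net exists, in particular for totally bounded sets.
\<close>

definition covering_number :: "'a::metric_space set \<Rightarrow> real \<Rightarrow> nat" where
  "covering_number \<Theta> \<epsilon> = (LEAST k. \<exists>\<N>. finite \<N> \<and> eps_net \<Theta> \<epsilon> \<N> \<and> card \<N> = k)"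

text \<open>
  Nets are required to lie inside the set, whereas the library constant \<open>totally_bounded\<close> allows
  arbitrary centres.
\<close>

definition totally_bounded_set :: "'a::metric_space set \<Rightarrow> bool" where
  "totally_bounded_set \<Theta> \<longleftrightarrow> (\<forall>\<epsilon>>0. \<exists>\<N>. finite \<N> \<and> eps_net \<Theta> \<epsilon> \<N>)"

text \<open>
  A data point is a pair \<open>z = (x, y)\<close>. The risks are Bochner integrals, hence \<open>0\<close> if the loss is
  not integrable, so integrability must be assumed wherever a risk is said to be finite.
\<close>

definition residual :: "(real^'d) \<Rightarrow> (real^'d) \<times> real \<Rightarrow> real" where
  "residual \<theta> z = snd z - fst z \<bullet> \<theta>"

definition risk_l1 :: "((real^'d) \<times> real) measure \<Rightarrow> (real^'d) \<Rightarrow> real" where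
  "risk_l1 \<mu> \<theta> = (\<integral>z. \<bar>residual \<theta> z\<bar> \<partial>\<mu>)"

definition risk_lalpha :: "((real^'d) \<times> real) measure \<Rightarrow> real \<Rightarrow> (real^'d) \<Rightarrow> real" where
  "risk_lalpha \<mu> \<alpha> \<theta> = (\<integral>z. \<bar>residual \<theta> z\<bar> powr \<alpha> \<partial>\<mu>)"

definition emp_risk ::
    "(real \<Rightarrow> real) \<Rightarrow> real \<Rightarrow> nat \<Rightarrow> (nat \<Rightarrow> (real^'d) \<times> real) \<Rightarrow> (real^'d) \<Rightarrow> real" where
  "emp_risk \<phi> \<beta> n z \<theta> = 1 / (real n * \<beta>) * (\<Sum>i=1..n. \<phi> (\<beta> * \<bar>residual \<theta> (z i)\<bar>))"

definition scale_beta :: "(real^'d) set \<Rightarrow> real \<Rightarrow> real \<Rightarrow> nat \<Rightarrow> real" where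
  "scale_beta \<Theta> \<alpha> \<delta> n =
     (1 / real n * ln (real (covering_number \<Theta> (1 / real n)) / \<delta>\<^sup>2)) powr (1 / \<alpha>)"

text \<open>
  The moments of \<open>x\<^sub>1\<close> are written as integrals over its law \<open>\<mu>\<close>, so that the bound is a
  deterministic function of \<open>n\<close>. If \<open>d log (6nr) + log (1/\<delta>\<^sup>2)\<close> is negative, which happens only for
  very small \<open>n r\<close>, its fractional power is undefined on paper; here \<open>powr\<close> is then nonnegative.
\<close>

definition excess_bound ::
    "((real^'d) \<times> real) measure \<Rightarrow> (real^'d) set \<Rightarrow> real \<Rightarrow> real \<Rightarrow> real \<Rightarrow> nat \<Rightarrow> real" where
  "excess_bound \<mu> \<Theta> \<alpha> \<delta> r n =
     2 / real n * (\<integral>z. norm (fst z) \<partial>\<mu>)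
     + (2 powr (\<alpha> - 1) / (\<alpha> * real n powr \<alpha>) * (\<integral>z. norm (fst z) powr \<alpha> \<partial>\<mu>)
        + (2 powr (\<alpha> - 1) + 1) / \<alpha> * (SUP \<theta>\<in>\<Theta>. risk_lalpha \<mu> \<alpha> \<theta>)
        + 1)
       * (1 / real n * (real CARD('d) * ln (6 * real n * r) + ln (1 / \<delta>\<^sup>2)))
           powr ((\<alpha> - 1) / \<alpha>)"

text \<open>
  ``With probability at least \<open>p\<close>, \<open>P\<close> holds'', without presupposing that the set where \<open>P\<close> holds is
  measurable. If it is, this is equivalent to that set having probability at least \<open>p\<close>.
\<close>

definition with_prob_at_least :: "'w measure \<Rightarrow> real \<Rightarrow> ('w \<Rightarrow> bool) \<Rightarrow> bool" where
  "with_prob_at_least M p P \<longleftrightarrow> (\<exists>A\<in>sets M. measure M A \<ge> p \<and> (\<forall>\<omega>\<in>A. P \<omega>))"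

end

theory Submission
  imports Defs "HOL-Real_Asymp.Real_Asymp"
begin

text \<open>
  The function \<open>\<phi>\<close> tempers large losses just enough that an \<open>\<alpha>\<close>-th moment yields exponential
  deviation bounds. The upper bound on \<open>\<phi>\<close> says \<open>exp (\<phi> v) \<le> 1 + v + \<bar>v\<bar>\<^sup>\<alpha> / \<alpha>\<close>, so the
  exponential moment of \<open>\<phi> (v)\<close> is controlled by \<open>E v\<close> and \<open>E \<bar>v\<bar>\<^sup>\<alpha>\<close>, and Chernoff's argument
  applies to the sum over the sample (\<open>catoni_deviation\<close>). The lower bound on \<open>\<phi>\<close> is the same
  statement for \<open>\<lambda>x. - \<phi> (- x)\<close>, which gives the other tail.

  The upper tail is needed at the single point \<open>\<theta>_star\<close> (\<open>emp_risk_upper\<close>, failure probability \<open>\<delta>\<close>).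
  The lower tail must hold at the random point \<open>\<theta>_hat\<close>. If \<open>\<theta>\<close> is a point of an \<open>\<epsilon>\<close>-net next to it,
  then \<open>\<bar>y - x \<bullet> \<theta>_hat\<bar> \<ge> \<bar>y - x \<bullet> \<theta>\<bar> - \<epsilon> \<bar>x\<bar>\<close>, and monotonicity of \<open>\<phi>\<close> bounds the empirical risk
  at \<open>\<theta>_hat\<close> from below by a sum that depends on the net point alone. That sum deviates with
  probability at most \<open>\<delta> / N\<close> (\<open>emp_risk_lower_near\<close>), and a union bound over the \<open>N\<close> points of the
  net costs another \<open>\<delta>\<close>. Every exceptional event is thus attached to a fixed parameter, so it is
  measurable no matter how \<open>\<theta>_hat\<close> depends on the sample.
  The two tails and the Lipschitz continuity of the risk combine to \<open>excess_risk_net\<close>.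

  In that bound a bias of order \<open>\<beta>\<^sup>\<alpha>\<^sup>-\<^sup>1\<close> competes with the fluctuation \<open>ln (N / \<delta>\<^sup>2) / (n \<beta>)\<close>. The
  prescribed \<open>\<beta>\<close> satisfies \<open>\<beta>\<^sup>\<alpha> = ln (N / \<delta>\<^sup>2) / n\<close>, so the fluctuation equals \<open>\<beta>\<^sup>\<alpha>\<^sup>-\<^sup>1\<close> exactly.
  A volume comparison gives \<open>N \<le> (1 + 2 n r)\<^sup>d\<close>, which is at most \<open>(6 n r)\<^sup>d\<close> once \<open>n r \<ge> 1/4\<close>. For
  small \<open>n r\<close> this comparison, and even the sign of \<open>ln (6 n r)\<close>, is lost; but whenever \<open>n r \<le> 1\<close>
  any two parameters are at distance at most \<open>2 r \<le> 2 / n\<close>, and the term \<open>(2 / n) E \<bar>x\<bar>\<close> alone bounds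
  the excess risk.
\<close>

section \<open>Two inequalities for real powers\<close>

text \<open>
  Positivity makes \<open>\<psi> v \<le> ln (1 + v + \<bar>v\<bar>\<^sup>\<alpha> / \<alpha>)\<close> equivalent to a bound on \<open>exp (\<psi> v)\<close>. It is
  Young's inequality \<open>\<bar>v\<bar> \<cdot> 1 \<le> \<bar>v\<bar>\<^sup>\<alpha> / \<alpha> + 1 / q\<close> for the conjugate exponent \<open>q > 1\<close>.
\<close>

lemma catoni_majorant_pos:
  fixes v \<alpha> :: real
  assumes "1 < \<alpha>"
  shows "0 < 1 + v + \<bar>v\<bar> powr \<alpha> / \<alpha>"
proof -
  define q where "q = \<alpha> / (\<alpha> - 1)"
  have q: "1 < q" "1 / \<alpha> + 1 / q = 1"
    using assms by (auto simp: q_def field_simps)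
  have "\<bar>v\<bar> * 1 \<le> \<bar>v\<bar> powr \<alpha> / \<alpha> + 1 powr q / q"
    using assms q by (intro Youngs_inequality) auto
  moreover have "1 / q < 1"
    using q by simp
  ultimately show ?thesis
    by simp
qed

text \<open>
  This is midpoint convexity of \<open>t\<^sup>p\<close>. Convexity is used on the open half-line, so a vanishing
  summand is a separate case.
\<close>

lemma add_powr_le:
  fixes a b p :: real
  assumes "1 \<le> p" "0 \<le> a" "0 \<le> b"
  shows "(a + b) powr p \<le> 2 powr (p - 1) * (a powr p + b powr p)"
proof (cases "a = 0 \<or> b = 0")
  case True
  have "1 \<le> (2::real) powr (p - 1)"
    using assms by (intro ge_one_powr_ge_zero) auto
  then have "1 * c \<le> 2 powr (p - 1) * c" if "0 \<le> c" for c
    using that by (intro mult_right_mono)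
  with True show ?thesis
    by auto
next
  case False
  then have pos: "0 < a" "0 < b"
    using assms by auto
  have "((1 - 1/2) *\<^sub>R a + (1/2) *\<^sub>R b) powr p \<le> (1 - 1/2) * a powr p + (1/2) * b powr p"
    using pos assms by (intro convex_onD[OF powr_convex]) auto
  then have "2 powr p * ((a + b) / 2) powr p \<le> 2 powr p * ((a powr p + b powr p) / 2)"
    by (intro mult_left_mono) (auto simp: add_divide_distrib)
  moreover have "2 powr p * ((a + b) / 2) powr p = (a + b) powr p"
    using pos by (simp add: powr_divide)
  moreover have "2 powr p * ((a powr p + b powr p) / 2) = 2 powr (p - 1) * (a powr p + b powr p)"
    by (simp add: powr_diff)
  ultimately show ?thesis
    by (simp only:)
qed

section \<open>A deviation inequality of Catoni type\<close>

text \<open>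
  Chernoff's method with \<open>g = 1 + f + \<bar>f\<bar>\<^sup>\<alpha> / \<alpha>\<close> in place of an exponential: the exponential of the
  sum is at most \<open>\<Prod>i. g (Z i)\<close>, whose mean is \<open>(1 + m)\<^sup>n \<le> exp (n m)\<close> by independence, where
  \<open>m = E f + E \<bar>f\<bar>\<^sup>\<alpha> / \<alpha>\<close>. Markov's inequality is applied to the product, so that \<open>exp (\<psi> (f z))\<close>
  itself never has to be integrated. Since \<open>f\<close> may have either sign, the lemma serves both tails.
\<close>

lemma (in prob_space) catoni_deviation:
  fixes Z :: "'i \<Rightarrow> 'a \<Rightarrow> 'b" and f :: "'b \<Rightarrow> real" and \<psi> :: "real \<Rightarrow> real"
  assumes \<alpha>: "1 < \<alpha>"
    and I: "finite I"
    and indep: "indep_vars (\<lambda>_. N) Z I"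
    and law: "\<And>i. i \<in> I \<Longrightarrow> distr M N (Z i) = \<mu>"
    and \<mu>: "prob_space \<mu>"
    and f [measurable]: "f \<in> borel_measurable N"
    and \<psi> [measurable]: "\<psi> \<in> borel_measurable borel"
    and \<psi>_le: "\<And>x. \<psi> x \<le> ln (1 + x + \<bar>x\<bar> powr \<alpha> / \<alpha>)"
    and int: "integrable \<mu> f" "integrable \<mu> (\<lambda>z. \<bar>f z\<bar> powr \<alpha>)"
  shows "prob {\<omega> \<in> space M.
      real (card I) * ((\<integral>z. f z \<partial>\<mu>) + (\<integral>z. \<bar>f z\<bar> powr \<alpha> \<partial>\<mu>) / \<alpha>) + t
        \<le> (\<Sum>i\<in>I. \<psi> (f (Z i \<omega>)))} \<le> exp (- t)"
proof -
  interpret mu: prob_space \<mu> by fact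
  define g where "g z = 1 + f z + \<bar>f z\<bar> powr \<alpha> / \<alpha>" for z
  define m where "m = (\<integral>z. f z \<partial>\<mu>) + (\<integral>z. \<bar>f z\<bar> powr \<alpha> \<partial>\<mu>) / \<alpha>"
  define c where "c = exp (real (card I) * m + t)"
  have Z [measurable]: "Z i \<in> measurable M N" if "i \<in> I" for i
    using indep that by (auto simp: indep_vars_def)
  have g_pos: "0 < g z" for z
    unfolding g_def using \<alpha> by (rule catoni_majorant_pos)
  have g [measurable]: "g \<in> borel_measurable N"
    unfolding g_def by measurable
  have int_g: "integrable \<mu> g" "(\<integral>z. g z \<partial>\<mu>) = 1 + m"
    unfolding g_def m_def using int by (auto simp: mu.prob_space)
  have int_gZ: "integrable M (\<lambda>\<omega>. g (Z i \<omega>))"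
    "expectation (\<lambda>\<omega>. g (Z i \<omega>)) = 1 + m" if "i \<in> I" for i
  proof -
    show "integrable M (\<lambda>\<omega>. g (Z i \<omega>))"
      using int_g(1) that unfolding law[OF that, symmetric]
      by (subst (asm) integrable_distr_eq) auto
    show "expectation (\<lambda>\<omega>. g (Z i \<omega>)) = 1 + m"
      using int_g(2) that unfolding law[OF that, symmetric]
      by (subst (asm) integral_distr) auto
  qed
  have indep_g: "indep_vars (\<lambda>_. borel) (\<lambda>i \<omega>. g (Z i \<omega>)) I"
    by (rule indep_vars_compose2[OF indep]) auto
  have int_prod: "integrable M (\<lambda>\<omega>. \<Prod>i\<in>I. g (Z i \<omega>))"
    using I indep_g int_gZ by (intro indep_vars_integrable) auto
  have exp_prod: "expectation (\<lambda>\<omega>. \<Prod>i\<in>I. g (Z i \<omega>)) = (1 + m) ^ card I"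
    using I indep_g int_gZ by (subst indep_vars_lebesgue_integral) auto
  have m_ge: "0 \<le> 1 + m"
    unfolding int_g(2)[symmetric] using g_pos by (intro Bochner_Integration.integral_nonneg) (auto intro: less_imp_le)
  have sub: "c \<le> (\<Prod>i\<in>I. g (Z i \<omega>))"
    if "real (card I) * m + t \<le> (\<Sum>i\<in>I. \<psi> (f (Z i \<omega>)))" for \<omega>
  proof -
    have "c \<le> exp (\<Sum>i\<in>I. \<psi> (f (Z i \<omega>)))"
      using that by (simp add: c_def)
    also have "\<dots> = (\<Prod>i\<in>I. exp (\<psi> (f (Z i \<omega>))))"
      using I by (simp add: exp_sum)
    also have "\<dots> \<le> (\<Prod>i\<in>I. g (Z i \<omega>))"
    proof (rule prod_mono)
      fix i
      have "exp (\<psi> (f (Z i \<omega>))) \<le> exp (ln (g (Z i \<omega>)))"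
        using \<psi>_le by (simp add: g_def)
      with g_pos show "0 \<le> exp (\<psi> (f (Z i \<omega>))) \<and> exp (\<psi> (f (Z i \<omega>))) \<le> g (Z i \<omega>)"
        by simp
    qed
    finally show ?thesis .
  qed
  have "prob {\<omega> \<in> space M. real (card I) * m + t \<le> (\<Sum>i\<in>I. \<psi> (f (Z i \<omega>)))}
      \<le> prob {\<omega> \<in> space M. c \<le> (\<Prod>i\<in>I. g (Z i \<omega>))}"
    using sub by (intro finite_measure_mono) auto
  also have "\<dots> \<le> (1 + m) ^ card I / c"
    unfolding exp_prod[symmetric]
    by (rule integral_Markov_inequality_measure[where A = "{}"])
      (use int_prod g_pos in \<open>auto simp: c_def intro!: AE_I2 prod_nonneg intro: less_imp_le\<close>)
  also have "\<dots> \<le> exp m ^ card I / c"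
    using m_ge by (intro divide_right_mono power_mono) (auto simp: c_def)
  also have "\<dots> = exp (- t)"
    by (simp add: c_def exp_of_nat_mult[symmetric] exp_add exp_minus field_simps)
  finally show ?thesis
    by (simp add: m_def)
qed

section \<open>Covering numbers of bounded sets\<close>

text \<open>
  The balls of radius \<open>\<epsilon> / 2\<close> around the points are disjoint and lie in the ball of radius
  \<open>r + \<epsilon> / 2\<close> around the origin; comparing volumes bounds their number.
\<close>

lemma card_separated_le:
  fixes S :: "'a::euclidean_space set"
  assumes S: "finite S" "S \<subseteq> cball 0 r"
    and sep: "\<And>x y. x \<in> S \<Longrightarrow> y \<in> S \<Longrightarrow> x \<noteq> y \<Longrightarrow> \<epsilon> < dist x y"
    and "0 < \<epsilon>" "0 \<le> r"
  shows "real (card S) \<le> (1 + 2 * r / \<epsilon>) ^ DIM('a)"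
proof -
  have disj: "disjoint_family_on (\<lambda>x. ball x (\<epsilon> / 2)) S"
    unfolding disjoint_family_on_def
  proof (intro ballI impI)
    fix x y assume xy: "x \<in> S" "y \<in> S" "x \<noteq> y"
    show "ball x (\<epsilon> / 2) \<inter> ball y (\<epsilon> / 2) = {}"
    proof (rule ccontr)
      assume "\<not> ?thesis"
      then obtain z where "dist x z < \<epsilon> / 2" "dist y z < \<epsilon> / 2"
        by auto
      then have "dist x y < \<epsilon>"
        using dist_triangle2[of x y z] by linarith
      with sep[OF xy] show False
        by simp
    qed
  qed
  define V where "V = unit_ball_vol (real DIM('a))"
  have V: "V > 0"
    by (simp add: V_def)
  have "(\<Sum>x\<in>S. measure lborel (ball x (\<epsilon> / 2))) = measure lborel (\<Union>x\<in>S. ball x (\<epsilon> / 2))"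
    using S disj \<open>0 < \<epsilon>\<close> by (intro measure_finite_Union[symmetric]) (auto simp: emeasure_ball)
  also have "\<dots> \<le> measure lborel (ball (0::'a) (r + \<epsilon> / 2))"
  proof (rule measure_mono_fmeasurable)
    show "(\<Union>x\<in>S. ball x (\<epsilon> / 2)) \<subseteq> ball 0 (r + \<epsilon> / 2)"
    proof safe
      fix x z assume "x \<in> S" "z \<in> ball x (\<epsilon> / 2)"
      with S have "dist 0 x \<le> r" "dist x z < \<epsilon> / 2"
        by auto
      then show "z \<in> ball 0 (r + \<epsilon> / 2)"
        using dist_triangle[of 0 z x] by simp
    qed
  qed (auto intro!: borel_open simp: fmeasurable_def emeasure_ball \<open>0 < \<epsilon>\<close> \<open>0 \<le> r\<close> less_imp_le)
  finally have "real (card S) * (V * (\<epsilon> / 2) ^ DIM('a)) \<le> V * (r + \<epsilon> / 2) ^ DIM('a)"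
    using assms by (simp add: content_ball V_def)
  then have "real (card S) * (\<epsilon> / 2) ^ DIM('a) \<le> (r + \<epsilon> / 2) ^ DIM('a)"
    using V by (simp add: mult.left_commute)
  then have "real (card S) \<le> (r + \<epsilon> / 2) ^ DIM('a) / (\<epsilon> / 2) ^ DIM('a)"
    using \<open>0 < \<epsilon>\<close> by (simp add: pos_le_divide_eq)
  also have "\<dots> = ((r + \<epsilon> / 2) / (\<epsilon> / 2)) ^ DIM('a)"
    by (rule power_divide[symmetric])
  also have "(r + \<epsilon> / 2) / (\<epsilon> / 2) = 1 + 2 * r / \<epsilon>"
    using \<open>0 < \<epsilon>\<close> by (simp add: field_simps)
  finally show ?thesis .
qed

text \<open>
  A separated subset of maximal cardinality is a net, since a point far from all its elements could
  be added to it. Its centres lie in \<open>\<Theta>\<close>, as \<open>eps_net\<close> demands.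
\<close>

lemma exists_small_net:
  fixes \<Theta> :: "'a::euclidean_space set"
  assumes \<Theta>: "\<Theta> \<subseteq> cball 0 r" and "0 < \<epsilon>" "0 \<le> r"
  shows "\<exists>\<N>. finite \<N> \<and> eps_net \<Theta> \<epsilon> \<N> \<and> real (card \<N>) \<le> (1 + 2 * r / \<epsilon>) ^ DIM('a)"
proof -
  define sep where "sep S \<longleftrightarrow> finite S \<and> S \<subseteq> \<Theta> \<and> (\<forall>x\<in>S. \<forall>y\<in>S. x \<noteq> y \<longrightarrow> \<epsilon> < dist x y)"
    for S
  have bound: "real (card S) \<le> (1 + 2 * r / \<epsilon>) ^ DIM('a)" if "sep S" for S
    using that assms by (intro card_separated_le) (auto simp: sep_def)
  have "\<exists>S. sep S \<and> (\<forall>T. sep T \<longrightarrow> card T \<le> card S)"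
  proof (rule ex_has_greatest_nat)
    show "sep {}"
      by (simp add: sep_def)
    show "\<forall>S. sep S \<longrightarrow> card S < Suc (nat \<lfloor>(1 + 2 * r / \<epsilon>) ^ DIM('a)\<rfloor>)"
      using bound by (auto simp: le_nat_floor less_Suc_eq_le)
  qed
  then obtain S where S: "sep S" and maxi: "\<And>T. sep T \<Longrightarrow> card T \<le> card S"
    by blast
  have "\<exists>\<theta>'\<in>S. dist \<theta> \<theta>' \<le> \<epsilon>" if "\<theta> \<in> \<Theta>" for \<theta>
  proof (rule ccontr)
    assume neg: "\<not> ?thesis"
    with \<open>0 < \<epsilon>\<close> have "\<theta> \<notin> S"
      by (metis dist_self less_imp_le)
    moreover from neg have "sep (insert \<theta> S)"
      using S that by (auto simp: sep_def dist_commute not_le)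
    ultimately show False
      using maxi[of "insert \<theta> S"] S by (simp add: sep_def)
  qed
  with S bound[OF S] show ?thesis
    by (auto simp: sep_def eps_net_def)
qed

lemma covering_number_le:
  assumes "finite \<N>" "eps_net \<Theta> \<epsilon> \<N>"
  shows "covering_number \<Theta> \<epsilon> \<le> card \<N>"
  unfolding covering_number_def using assms by (intro Least_le) auto

lemma covering_number_attained:
  assumes "finite \<N>" "eps_net \<Theta> \<epsilon> \<N>"
  obtains \<N>' where "finite \<N>'" "eps_net \<Theta> \<epsilon> \<N>'" "card \<N>' = covering_number \<Theta> \<epsilon>"
proof -
  have "\<exists>\<N>'. finite \<N>' \<and> eps_net \<Theta> \<epsilon> \<N>' \<and> card \<N>' = covering_number \<Theta> \<epsilon>"
    unfolding covering_number_def
    by (rule LeastI_ex) (use assms in blast)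
  with that show ?thesis
    by blast
qed

section \<open>The risks\<close>

lemma measurable_residual [measurable]: "residual \<theta> \<in> borel_measurable borel"
  unfolding residual_def
  by (intro borel_measurable_continuous_onI continuous_intros)

lemma measurable_norm_fst [measurable]:
  "(\<lambda>z::(real^'d) \<times> real. norm (fst z)) \<in> borel_measurable borel"
  by (intro borel_measurable_continuous_onI continuous_intros)

lemma (in finite_measure) integrable_of_integrable_powr:
  fixes f :: "'a \<Rightarrow> real"
  assumes [measurable]: "f \<in> borel_measurable M"
    and "integrable M (\<lambda>z. \<bar>f z\<bar> powr p)" "1 \<le> p"
  shows "integrable M f"
proof (rule Bochner_Integration.integrable_bound)
  show "integrable M (\<lambda>z. 1 + \<bar>f z\<bar> powr p)"
    using assms by auto
  have "\<bar>x\<bar> \<le> 1 + \<bar>x\<bar> powr p" for x :: real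
  proof (cases "\<bar>x\<bar> \<le> 1")
    case False
    then have "\<bar>x\<bar> powr 1 \<le> \<bar>x\<bar> powr p"
      using assms by (intro powr_mono) auto
    with False show ?thesis
      by simp
  qed (simp add: add_increasing2)
  then show "AE z in M. norm (f z) \<le> norm (1 + \<bar>f z\<bar> powr p)"
    by (simp add: abs_of_nonneg)
qed simp

lemma abs_residual_diff_le:
  "\<bar>residual \<theta> z\<bar> \<le> \<bar>residual \<theta>' z\<bar> + dist \<theta> \<theta>' * norm (fst z)"
proof -
  have "\<bar>residual \<theta> z - residual \<theta>' z\<bar> = \<bar>fst z \<bullet> (\<theta>' - \<theta>)\<bar>"
    by (simp add: residual_def inner_diff_right)
  also have "\<dots> \<le> norm (fst z) * norm (\<theta>' - \<theta>)"
    by (rule Cauchy_Schwarz_ineq2)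
  finally show ?thesis
    by (simp add: dist_norm norm_minus_commute mult.commute)
qed

lemma risk_l1_lipschitz:
  assumes "integrable \<mu> (residual \<theta>)" "integrable \<mu> (residual \<theta>')"
    and "integrable \<mu> (\<lambda>z. norm (fst z))"
  shows "risk_l1 \<mu> \<theta> \<le> risk_l1 \<mu> \<theta>' + dist \<theta> \<theta>' * (\<integral>z. norm (fst z) \<partial>\<mu>)"
proof -
  have "risk_l1 \<mu> \<theta> \<le> (\<integral>z. \<bar>residual \<theta>' z\<bar> + dist \<theta> \<theta>' * norm (fst z) \<partial>\<mu>)"
    unfolding risk_l1_def using assms
    by (intro integral_mono) (auto intro: abs_residual_diff_le)
  also have "\<dots> = risk_l1 \<mu> \<theta>' + dist \<theta> \<theta>' * (\<integral>z. norm (fst z) \<partial>\<mu>)"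
    unfolding risk_l1_def using assms by simp
  finally show ?thesis .
qed

section \<open>The excess risk on a net\<close>

context prob_space
begin

text \<open>
  The deviation inequality for \<open>f z = \<beta> \<bar>residual \<theta> z\<bar>\<close>, divided by \<open>n \<beta>\<close>. The factor \<open>\<beta>\<^sup>\<alpha>\<close> of the
  \<open>\<alpha>\<close>-th moment then becomes \<open>\<beta>\<^sup>\<alpha>\<^sup>-\<^sup>1\<close>: a small \<open>\<beta>\<close> reduces the bias and inflates \<open>t / (n \<beta>)\<close>.
\<close>

lemma emp_risk_upper:
  fixes \<mu> :: "((real^'d) \<times> real) measure"
  assumes \<alpha>: "1 < \<alpha>"
    and \<mu>: "prob_space \<mu>" "sets \<mu> = sets borel"
    and n: "1 \<le> n"
    and indep: "indep_vars (\<lambda>_. borel) Z {1..n}"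
    and law: "\<And>i. i \<in> {1..n} \<Longrightarrow> distr M borel (Z i) = \<mu>"
    and phi: "mono \<phi>" "\<And>x. \<phi> x \<le> ln (1 + x + \<bar>x\<bar> powr \<alpha> / \<alpha>)"
    and \<beta>: "0 < \<beta>"
    and int: "integrable \<mu> (\<lambda>z. \<bar>residual \<theta> z\<bar> powr \<alpha>)"
  shows "prob {\<omega> \<in> space M. risk_l1 \<mu> \<theta> + \<beta> powr (\<alpha> - 1) / \<alpha> * risk_lalpha \<mu> \<alpha> \<theta>
      + t / (real n * \<beta>) \<le> emp_risk \<phi> \<beta> n (\<lambda>i. Z i \<omega>) \<theta>} \<le> exp (- t)"
proof -
  interpret mu: prob_space \<mu> by fact
  note [measurable_cong] = \<mu>(2)
  let ?f = "\<lambda>z. \<beta> * \<bar>residual \<theta> z\<bar>"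
  have "integrable \<mu> (residual \<theta>)"
    by (rule mu.integrable_of_integrable_powr[where p = \<alpha>]) (use int \<alpha> in auto)
  then have f1: "integrable \<mu> ?f" and E1: "(\<integral>z. ?f z \<partial>\<mu>) = \<beta> * risk_l1 \<mu> \<theta>"
    by (auto simp: risk_l1_def)
  have pw: "\<bar>?f z\<bar> powr \<alpha> = \<beta> powr \<alpha> * \<bar>residual \<theta> z\<bar> powr \<alpha>" for z
    using \<beta> by (simp add: abs_mult powr_mult)
  have f2: "integrable \<mu> (\<lambda>z. \<bar>?f z\<bar> powr \<alpha>)"
    and E2: "(\<integral>z. \<bar>?f z\<bar> powr \<alpha> \<partial>\<mu>) = \<beta> powr \<alpha> * risk_lalpha \<mu> \<alpha> \<theta>"
    unfolding pw using int by (auto simp: risk_lalpha_def)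
  have "prob {\<omega> \<in> space M.
      real (card {1..n}) * ((\<integral>z. ?f z \<partial>\<mu>) + (\<integral>z. \<bar>?f z\<bar> powr \<alpha> \<partial>\<mu>) / \<alpha>) + t
        \<le> (\<Sum>i\<in>{1..n}. \<phi> (?f (Z i \<omega>)))} \<le> exp (- t)"
    by (rule catoni_deviation[OF \<alpha> _ indep law \<mu>(1)])
      (use phi f1 f2 in \<open>auto intro: borel_measurable_mono\<close>)
  moreover have "real (card {1..n}) * ((\<integral>z. ?f z \<partial>\<mu>) + (\<integral>z. \<bar>?f z\<bar> powr \<alpha> \<partial>\<mu>) / \<alpha>) + t
      = real n * \<beta> * (risk_l1 \<mu> \<theta> + \<beta> powr (\<alpha> - 1) / \<alpha> * risk_lalpha \<mu> \<alpha> \<theta> + t / (real n * \<beta>))"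
    unfolding E1 E2 using n \<beta> \<alpha> by (simp add: powr_diff field_simps)
  moreover have "real n * \<beta> * a \<le> s \<longleftrightarrow> a \<le> 1 / (real n * \<beta>) * s" for a s :: real
    using n \<beta> by (simp add: field_simps)
  ultimately show ?thesis
    by (simp add: emp_risk_def)
qed

text \<open>
  One exceptional event \<open>B\<close> has to serve all \<open>\<theta>'\<close> near \<open>\<theta>\<close> at once, because \<open>\<theta>'\<close> will be a random point.
  To this end the loss at \<open>\<theta>'\<close> is first bounded below by
  \<open>h z = \<bar>residual \<theta> z\<bar> - \<epsilon> \<bar>x\<bar>\<close>, which no longer involves \<open>\<theta>'\<close>. The deviation inequality is then
  used for \<open>\<lambda>x. - \<phi> (- x)\<close> and \<open>- \<beta> h\<close>. The price of the shift is the factor \<open>2\<^sup>\<alpha>\<^sup>-\<^sup>1\<close> in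
  \<open>E \<bar>h\<bar>\<^sup>\<alpha> \<le> 2\<^sup>\<alpha>\<^sup>-\<^sup>1 (E \<bar>residual \<theta>\<bar>\<^sup>\<alpha> + \<epsilon>\<^sup>\<alpha> E \<bar>x\<bar>\<^sup>\<alpha>)\<close>.
\<close>

lemma emp_risk_lower_near:
  fixes \<mu> :: "((real^'d) \<times> real) measure"
  assumes \<alpha>: "1 < \<alpha>"
    and \<mu>: "prob_space \<mu>" "sets \<mu> = sets borel"
    and n: "1 \<le> n"
    and indep: "indep_vars (\<lambda>_. borel) Z {1..n}"
    and law: "\<And>i. i \<in> {1..n} \<Longrightarrow> distr M borel (Z i) = \<mu>"
    and phi: "mono \<phi>" "\<And>x. - ln (1 - x + \<bar>x\<bar> powr \<alpha> / \<alpha>) \<le> \<phi> x"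
    and \<beta>: "0 < \<beta>" and \<epsilon>: "0 \<le> \<epsilon>"
    and int: "integrable \<mu> (\<lambda>z. \<bar>residual \<theta> z\<bar> powr \<alpha>)"
    and int_x: "integrable \<mu> (\<lambda>z. norm (fst z) powr \<alpha>)"
  shows "\<exists>B\<in>events. prob B \<le> exp (- t) \<and> (\<forall>\<omega>\<in>space M - B. \<forall>\<theta>'. dist \<theta> \<theta>' \<le> \<epsilon> \<longrightarrow>
      risk_l1 \<mu> \<theta> - \<epsilon> * (\<integral>z. norm (fst z) \<partial>\<mu>)
       - \<beta> powr (\<alpha> - 1) / \<alpha> * (2 powr (\<alpha> - 1) *
           (risk_lalpha \<mu> \<alpha> \<theta> + \<epsilon> powr \<alpha> * (\<integral>z. norm (fst z) powr \<alpha> \<partial>\<mu>)))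
       - t / (real n * \<beta>) \<le> emp_risk \<phi> \<beta> n (\<lambda>i. Z i \<omega>) \<theta>')"
proof -
  interpret mu: prob_space \<mu> by fact
  note [measurable_cong] = \<mu>(2)
  define h where "h z = \<bar>residual \<theta> z\<bar> - \<epsilon> * norm (fst z)" for z
  define X where "X = (\<integral>z. norm (fst z) \<partial>\<mu>)"
  define K where "K = 2 powr (\<alpha> - 1) *
           (risk_lalpha \<mu> \<alpha> \<theta> + \<epsilon> powr \<alpha> * (\<integral>z. norm (fst z) powr \<alpha> \<partial>\<mu>))"
  let ?f = "\<lambda>z. - (\<beta> * h z)"
  let ?\<psi> = "\<lambda>x. - \<phi> (- x)"
  have h_meas [measurable]: "h \<in> borel_measurable borel"
    unfolding h_def by measurable
  have int_res: "integrable \<mu> (residual \<theta>)"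
    by (rule mu.integrable_of_integrable_powr[where p = \<alpha>]) (use int \<alpha> in auto)
  have int_norm: "integrable \<mu> (\<lambda>z. norm (fst z))"
    by (rule mu.integrable_of_integrable_powr[where p = \<alpha>]) (use int_x \<alpha> in auto)
  have f1: "integrable \<mu> ?f" and E1: "(\<integral>z. ?f z \<partial>\<mu>) = - (\<beta> * (risk_l1 \<mu> \<theta> - \<epsilon> * X))"
    unfolding h_def X_def using int_res int_norm by (auto simp: risk_l1_def)
  have pw: "\<bar>?f z\<bar> powr \<alpha> = \<beta> powr \<alpha> * \<bar>h z\<bar> powr \<alpha>" for z
    using \<beta> by (simp add: abs_mult powr_mult)
  have h_le: "\<bar>h z\<bar> powr \<alpha>
      \<le> 2 powr (\<alpha> - 1) * (\<bar>residual \<theta> z\<bar> powr \<alpha> + \<epsilon> powr \<alpha> * norm (fst z) powr \<alpha>)" for z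
  proof -
    have "0 \<le> \<epsilon> * norm (fst z)"
      using \<epsilon> by simp
    then have "\<bar>h z\<bar> powr \<alpha> \<le> (\<bar>residual \<theta> z\<bar> + \<epsilon> * norm (fst z)) powr \<alpha>"
      unfolding h_def using \<alpha> by (intro powr_mono2) linarith+
    also have "\<dots> \<le> 2 powr (\<alpha> - 1) * (\<bar>residual \<theta> z\<bar> powr \<alpha> + (\<epsilon> * norm (fst z)) powr \<alpha>)"
      using \<alpha> \<epsilon> by (intro add_powr_le) auto
    finally show ?thesis
      using \<epsilon> by (simp add: powr_mult)
  qed
  have int_h: "integrable \<mu> (\<lambda>z. \<bar>h z\<bar> powr \<alpha>)"
    by (rule Bochner_Integration.integrable_bound[where
        f = "\<lambda>z. 2 powr (\<alpha> - 1) * (\<bar>residual \<theta> z\<bar> powr \<alpha> + \<epsilon> powr \<alpha> * norm (fst z) powr \<alpha>)"])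
      (use int int_x h_le in \<open>auto intro!: AE_I2 order_trans[OF _ abs_ge_self]\<close>)
  then have f2: "integrable \<mu> (\<lambda>z. \<bar>?f z\<bar> powr \<alpha>)"
    unfolding pw by simp
  have E2: "(\<integral>z. \<bar>?f z\<bar> powr \<alpha> \<partial>\<mu>) \<le> \<beta> powr \<alpha> * K"
  proof -
    have "(\<integral>z. \<bar>h z\<bar> powr \<alpha> \<partial>\<mu>) \<le> (\<integral>z. 2 powr (\<alpha> - 1) *
        (\<bar>residual \<theta> z\<bar> powr \<alpha> + \<epsilon> powr \<alpha> * norm (fst z) powr \<alpha>) \<partial>\<mu>)"
      using int int_x int_h h_le by (intro integral_mono) auto
    also have "\<dots> = K"
      unfolding K_def risk_lalpha_def using int int_x by simp
    finally show ?thesis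
      unfolding pw using \<beta> by simp
  qed
  define a where "a = real n * ((\<integral>z. ?f z \<partial>\<mu>) + (\<integral>z. \<bar>?f z\<bar> powr \<alpha> \<partial>\<mu>) / \<alpha>) + t"
  define B where "B = {\<omega> \<in> space M. a \<le> (\<Sum>i\<in>{1..n}. ?\<psi> (?f (Z i \<omega>)))}"
  have \<psi>_meas [measurable]: "?\<psi> \<in> borel_measurable borel"
    using borel_measurable_mono[OF phi(1)] by measurable
  have Z_meas [measurable]: "Z i \<in> measurable M borel" if "i \<in> {1..n}" for i
    using indep that by (auto simp: indep_vars_def)
  have \<psi>_le: "?\<psi> x \<le> ln (1 + x + \<bar>x\<bar> powr \<alpha> / \<alpha>)" for x
    using phi(2)[of "- x"] by simp
  have "a = real (card {1..n}) * ((\<integral>z. ?f z \<partial>\<mu>) + (\<integral>z. \<bar>?f z\<bar> powr \<alpha> \<partial>\<mu>) / \<alpha>) + t"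
    by (simp add: a_def)
  then have "prob B \<le> exp (- t)"
    unfolding B_def
    by (simp only:) (rule catoni_deviation[OF \<alpha> _ indep law \<mu>(1) _ \<psi>_meas \<psi>_le f1 f2]; measurable)
  moreover have "B \<in> events"
    unfolding B_def by measurable
  moreover have "risk_l1 \<mu> \<theta> - \<epsilon> * X - \<beta> powr (\<alpha> - 1) / \<alpha> * K - t / (real n * \<beta>)
      \<le> emp_risk \<phi> \<beta> n (\<lambda>i. Z i \<omega>) \<theta>'"
    if \<omega>: "\<omega> \<in> space M - B" and near: "dist \<theta> \<theta>' \<le> \<epsilon>" for \<omega> \<theta>'
  proof -
    have "a \<le> real n * (- (\<beta> * (risk_l1 \<mu> \<theta> - \<epsilon> * X)) + \<beta> powr \<alpha> * K / \<alpha>) + t"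
      unfolding a_def E1 using E2 \<alpha> by (intro add_mono mult_left_mono divide_right_mono) auto
    then have "real n * (\<beta> * (risk_l1 \<mu> \<theta> - \<epsilon> * X) - \<beta> powr \<alpha> * K / \<alpha>) - t \<le> - a"
      by (simp add: algebra_simps)
    also have "- a \<le> (\<Sum>i\<in>{1..n}. \<phi> (\<beta> * h (Z i \<omega>)))"
      using \<omega> by (auto simp: B_def sum_negf)
    also have "\<dots> \<le> (\<Sum>i\<in>{1..n}. \<phi> (\<beta> * \<bar>residual \<theta>' (Z i \<omega>)\<bar>))"
    proof (intro sum_mono monoD[OF phi(1)] mult_left_mono)
      fix i
      have "dist \<theta> \<theta>' * norm (fst (Z i \<omega>)) \<le> \<epsilon> * norm (fst (Z i \<omega>))"
        using near by (intro mult_right_mono) auto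
      then show "h (Z i \<omega>) \<le> \<bar>residual \<theta>' (Z i \<omega>)\<bar>"
        using abs_residual_diff_le[of \<theta> "Z i \<omega>" \<theta>'] unfolding h_def by linarith
    qed (use \<beta> in simp)
    finally have "(real n * (\<beta> * (risk_l1 \<mu> \<theta> - \<epsilon> * X) - \<beta> powr \<alpha> * K / \<alpha>) - t) / (real n * \<beta>)
        \<le> emp_risk \<phi> \<beta> n (\<lambda>i. Z i \<omega>) \<theta>'"
      unfolding emp_risk_def using n \<beta> by (simp add: divide_right_mono)
    moreover have "(real n * (\<beta> * (risk_l1 \<mu> \<theta> - \<epsilon> * X) - \<beta> powr \<alpha> * K / \<alpha>) - t) / (real n * \<beta>)
        = risk_l1 \<mu> \<theta> - \<epsilon> * X - \<beta> powr (\<alpha> - 1) / \<alpha> * K - t / (real n * \<beta>)"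
      using n \<beta> \<alpha> by (simp add: powr_diff field_simps)
    ultimately show ?thesis
      by simp
  qed
  ultimately show ?thesis
    unfolding X_def K_def by blast
qed

text \<open>
  With \<open>\<theta>\<close> the net point near \<open>\<theta>_hat\<close>, the bound is the chain \<open>R(\<theta>_hat) \<lesssim> R(\<theta>)\<close> (Lipschitz)
  \<open>\<lesssim> emp(\<theta>_hat)\<close> (lower tail) \<open>\<le> emp(\<theta>_star)\<close> (minimality) \<open>\<lesssim> R(\<theta>_star)\<close> (upper tail), outside
  exceptional events of total probability at most \<open>\<delta> + card \<N> \<cdot> \<delta> / card \<N>\<close>. The deviation levels are
  \<open>ln (1 / \<delta>)\<close> and \<open>ln (card \<N> / \<delta>)\<close>; they add up to \<open>ln (card \<N> / \<delta>\<^sup>2)\<close>.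
\<close>

theorem excess_risk_net:
  fixes \<mu> :: "((real^'d) \<times> real) measure"
  assumes \<alpha>: "1 < \<alpha>"
    and \<mu>: "prob_space \<mu>" "sets \<mu> = sets borel"
    and n: "1 \<le> n"
    and indep: "indep_vars (\<lambda>_. borel) Z {1..n}"
    and law: "\<And>i. i \<in> {1..n} \<Longrightarrow> distr M borel (Z i) = \<mu>"
    and phi: "mono \<phi>" "\<And>x. - ln (1 - x + \<bar>x\<bar> powr \<alpha> / \<alpha>) \<le> \<phi> x"
      "\<And>x. \<phi> x \<le> ln (1 + x + \<bar>x\<bar> powr \<alpha> / \<alpha>)"
    and \<beta>: "0 < \<beta>" and \<epsilon>: "0 \<le> \<epsilon>" and \<delta>: "0 < \<delta>"
    and net: "finite \<N>" "eps_net \<Theta> \<epsilon> \<N>"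
    and int: "\<And>\<theta>. \<theta> \<in> \<Theta> \<Longrightarrow> integrable \<mu> (\<lambda>z. \<bar>residual \<theta> z\<bar> powr \<alpha>)"
    and int_x: "integrable \<mu> (\<lambda>z. norm (fst z) powr \<alpha>)"
    and S: "\<And>\<theta>. \<theta> \<in> \<Theta> \<Longrightarrow> risk_lalpha \<mu> \<alpha> \<theta> \<le> S"
    and star: "\<theta>_star \<in> \<Theta>"
    and hat: "\<And>\<omega>. \<omega> \<in> space M \<Longrightarrow>
      is_arg_min (emp_risk \<phi> \<beta> n (\<lambda>i. Z i \<omega>)) (\<lambda>\<theta>. \<theta> \<in> \<Theta>) (\<theta>_hat \<omega>)"
  shows "with_prob_at_least M (1 - 2 * \<delta>) (\<lambda>\<omega>. risk_l1 \<mu> (\<theta>_hat \<omega>) - risk_l1 \<mu> \<theta>_star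
      \<le> 2 * \<epsilon> * (\<integral>z. norm (fst z) \<partial>\<mu>)
        + \<beta> powr (\<alpha> - 1) / \<alpha> * (2 powr (\<alpha> - 1) * \<epsilon> powr \<alpha> * (\<integral>z. norm (fst z) powr \<alpha> \<partial>\<mu>)
            + (2 powr (\<alpha> - 1) + 1) * S)
        + ln (real (card \<N>) / \<delta>\<^sup>2) / (real n * \<beta>))"
proof -
  interpret mu: prob_space \<mu> by fact
  note [measurable_cong] = \<mu>(2)
  define X where "X = (\<integral>z. norm (fst z) \<partial>\<mu>)"
  define X\<alpha> where "X\<alpha> = (\<integral>z. norm (fst z) powr \<alpha> \<partial>\<mu>)"
  define b where "b = \<beta> powr (\<alpha> - 1) / \<alpha>"
  define p where "p = 2 powr (\<alpha> - 1)"
  define k where "k = real (card \<N>)"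
  have b: "0 \<le> b" and p: "0 \<le> p"
    using \<alpha> by (auto simp: b_def p_def)
  have "\<N> \<noteq> {}"
    using net(2) star by (auto simp: eps_net_def)
  with net(1) have k: "0 < k"
    by (simp add: k_def card_gt_0_iff)
  have int_norm: "integrable \<mu> (\<lambda>z. norm (fst z))"
    by (rule mu.integrable_of_integrable_powr[where p = \<alpha>]) (use int_x \<alpha> in auto)
  have int_res: "integrable \<mu> (residual \<theta>)" if "\<theta> \<in> \<Theta>" for \<theta>
    by (rule mu.integrable_of_integrable_powr[where p = \<alpha>]) (use int[OF that] \<alpha> in auto)
  have X: "0 \<le> X"
    unfolding X_def by simp

  define B0 where "B0 = {\<omega> \<in> space M. risk_l1 \<mu> \<theta>_star + b * risk_lalpha \<mu> \<alpha> \<theta>_star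
      + ln (1 / \<delta>) / (real n * \<beta>) \<le> emp_risk \<phi> \<beta> n (\<lambda>i. Z i \<omega>) \<theta>_star}"
  have phi_meas [measurable]: "\<phi> \<in> borel_measurable borel"
    using phi(1) by (rule borel_measurable_mono)
  have Z_meas [measurable]: "Z i \<in> measurable M borel" if "i \<in> {1..n}" for i
    using indep that by (auto simp: indep_vars_def)
  have B0_meas: "B0 \<in> events"
    unfolding B0_def emp_risk_def by measurable
  have "prob B0 \<le> exp (- ln (1 / \<delta>))"
    unfolding B0_def b_def
    by (rule emp_risk_upper[OF \<alpha> \<mu> n indep law phi(1,3) \<beta> int[OF star]])
  then have B0: "prob B0 \<le> \<delta>"
    using \<delta> by (simp add: ln_div)

  have "\<exists>B\<in>events. prob B \<le> \<delta> / k \<and> (\<forall>\<omega>\<in>space M - B. \<forall>\<theta>'. dist \<theta> \<theta>' \<le> \<epsilon> \<longrightarrow>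
      risk_l1 \<mu> \<theta> - \<epsilon> * X - b * (p * (risk_lalpha \<mu> \<alpha> \<theta> + \<epsilon> powr \<alpha> * X\<alpha>))
       - ln (k / \<delta>) / (real n * \<beta>) \<le> emp_risk \<phi> \<beta> n (\<lambda>i. Z i \<omega>) \<theta>')" if "\<theta> \<in> \<N>" for \<theta>
  proof -
    have "\<theta> \<in> \<Theta>"
      using that net by (auto simp: eps_net_def)
    moreover have "exp (- ln (k / \<delta>)) = \<delta> / k"
      using \<delta> k by (simp add: exp_minus)
    ultimately show ?thesis
      using emp_risk_lower_near[OF \<alpha> \<mu> n indep law phi(1,2) \<beta> \<epsilon> int int_x, of \<theta> "ln (k / \<delta>)"]
      unfolding b_def p_def X_def X\<alpha>_def by simp
  qed
  then obtain B where B: "\<And>\<theta>. \<theta> \<in> \<N> \<Longrightarrow> B \<theta> \<in> events" "\<And>\<theta>. \<theta> \<in> \<N> \<Longrightarrow> prob (B \<theta>) \<le> \<delta> / k"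
    and lower: "\<And>\<theta> \<omega> \<theta>'. \<theta> \<in> \<N> \<Longrightarrow> \<omega> \<in> space M - B \<theta> \<Longrightarrow> dist \<theta> \<theta>' \<le> \<epsilon> \<Longrightarrow>
      risk_l1 \<mu> \<theta> - \<epsilon> * X - b * (p * (risk_lalpha \<mu> \<alpha> \<theta> + \<epsilon> powr \<alpha> * X\<alpha>))
       - ln (k / \<delta>) / (real n * \<beta>) \<le> emp_risk \<phi> \<beta> n (\<lambda>i. Z i \<omega>) \<theta>'"
    by metis

  define Bad where "Bad = B0 \<union> (\<Union>\<theta>\<in>\<N>. B \<theta>)"
  have UN_meas: "(\<Union>\<theta>\<in>\<N>. B \<theta>) \<in> events"
    using net(1) B(1) by auto
  have "prob (\<Union>\<theta>\<in>\<N>. B \<theta>) \<le> (\<Sum>\<theta>\<in>\<N>. prob (B \<theta>))"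
    using net(1) B(1) by (intro finite_measure_subadditive_finite) auto
  also have "\<dots> \<le> (\<Sum>\<theta>\<in>\<N>. \<delta> / k)"
    using B(2) by (intro sum_mono)
  also have "\<dots> = \<delta>"
    using k by (simp add: k_def)
  finally have "prob (\<Union>\<theta>\<in>\<N>. B \<theta>) \<le> \<delta>" .
  moreover have "prob Bad \<le> prob B0 + prob (\<Union>\<theta>\<in>\<N>. B \<theta>)"
    unfolding Bad_def using B0_meas UN_meas by (intro measure_Un_le)
  ultimately have "prob Bad \<le> 2 * \<delta>"
    using B0 by linarith
  moreover have Bad_meas: "Bad \<in> events"
    unfolding Bad_def using B0_meas UN_meas by auto
  ultimately have prob_good: "1 - 2 * \<delta> \<le> prob (space M - Bad)"
    by (simp add: prob_compl)

  have "risk_l1 \<mu> (\<theta>_hat \<omega>) - risk_l1 \<mu> \<theta>_star \<le> 2 * \<epsilon> * X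
      + b * (p * \<epsilon> powr \<alpha> * X\<alpha> + (p + 1) * S) + ln (k / \<delta>\<^sup>2) / (real n * \<beta>)"
    if \<omega>: "\<omega> \<in> space M - Bad" for \<omega>
  proof -
    let ?R = "emp_risk \<phi> \<beta> n (\<lambda>i. Z i \<omega>)"
    have hat_in: "\<theta>_hat \<omega> \<in> \<Theta>" and hat_le: "?R (\<theta>_hat \<omega>) \<le> ?R \<theta>_star"
      using hat[of \<omega>] \<omega> star by (auto simp: is_arg_min_linorder)
    obtain \<theta> where \<theta>: "\<theta> \<in> \<N>" "dist (\<theta>_hat \<omega>) \<theta> \<le> \<epsilon>"
      using net(2) hat_in by (auto simp: eps_net_def)
    then have \<theta>_in: "\<theta> \<in> \<Theta>"
      using net(2) by (auto simp: eps_net_def)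
    have "risk_l1 \<mu> (\<theta>_hat \<omega>) \<le> risk_l1 \<mu> \<theta> + dist (\<theta>_hat \<omega>) \<theta> * X"
      unfolding X_def using hat_in \<theta>_in int_res int_norm by (intro risk_l1_lipschitz) auto
    also have "dist (\<theta>_hat \<omega>) \<theta> * X \<le> \<epsilon> * X"
      using \<theta>(2) X by (rule mult_right_mono)
    finally have 1: "risk_l1 \<mu> (\<theta>_hat \<omega>) \<le> risk_l1 \<mu> \<theta> + \<epsilon> * X"
      by simp
    have 2: "risk_l1 \<mu> \<theta> - \<epsilon> * X - b * (p * (risk_lalpha \<mu> \<alpha> \<theta> + \<epsilon> powr \<alpha> * X\<alpha>))
       - ln (k / \<delta>) / (real n * \<beta>) \<le> ?R (\<theta>_hat \<omega>)"
      using \<omega> \<theta> by (intro lower) (auto simp: Bad_def dist_commute)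
    have 3: "?R \<theta>_star \<le> risk_l1 \<mu> \<theta>_star + b * risk_lalpha \<mu> \<alpha> \<theta>_star
        + ln (1 / \<delta>) / (real n * \<beta>)"
      using \<omega> by (auto simp: Bad_def B0_def)
    have 4: "b * (p * (risk_lalpha \<mu> \<alpha> \<theta> + \<epsilon> powr \<alpha> * X\<alpha>)) \<le> b * (p * (S + \<epsilon> powr \<alpha> * X\<alpha>))"
      using S[OF \<theta>_in] b p by (intro mult_left_mono) auto
    have 5: "b * risk_lalpha \<mu> \<alpha> \<theta>_star \<le> b * S"
      using S[OF star] b by (intro mult_left_mono) auto
    have 6: "ln (k / \<delta>\<^sup>2) / (real n * \<beta>)
        = ln (k / \<delta>) / (real n * \<beta>) + ln (1 / \<delta>) / (real n * \<beta>)"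
      unfolding add_divide_distrib[symmetric] using k \<delta> by (simp add: ln_div ln_realpow)
    from 1 2 3 4 5 6 hat_le show ?thesis
      by (simp add: algebra_simps)
  qed
  with prob_good Bad_meas show ?thesis
    unfolding with_prob_at_least_def X_def X\<alpha>_def b_def p_def k_def
    by (intro bexI[of _ "space M - Bad"]) (auto simp del: mult_eq_0_iff)
qed

end

section \<open>The rate of the bound\<close>

text \<open>
  The bracket of the bound stays bounded and its last factor has the stated order. The first term is
  smaller, because \<open>1 / k\<close> decays faster than \<open>(ln k / k)\<^sup>\<gamma>\<close> for \<open>\<gamma> < 1\<close>.
\<close>

lemma excess_bound_rate:
  fixes \<mu> :: "((real^'d) \<times> real) measure"
  assumes \<alpha>: "1 < \<alpha>" and "0 < r"
  shows "(\<lambda>k. excess_bound \<mu> \<Theta> \<alpha> \<delta> r k)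
           \<in> O(\<lambda>k. (real CARD('d) * ln (real k) / real k) powr ((\<alpha> - 1) / \<alpha>))"
proof -
  define \<gamma> where "\<gamma> = (\<alpha> - 1) / \<alpha>"
  define d where "d = real CARD('d)"
  have \<gamma>: "0 < \<gamma>" "\<gamma> < 1"
    using \<alpha> by (auto simp: \<gamma>_def)
  have d: "0 < d"
    by (simp add: d_def)
  have 1: "(\<lambda>k::nat. 2 / real k * A) \<in> O(\<lambda>k. (d * ln (real k) / real k) powr \<gamma>)" for A
  proof -
    have "(\<lambda>k::nat. 2 / real k) \<in> O(\<lambda>k. (d * ln (real k) / real k) powr \<gamma>)"
      using \<gamma> d by real_asymp
    from landau_o.big.mult[OF this, of "\<lambda>_. A" "\<lambda>_. 1"] show ?thesis
      by simp
  qed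
  have 2: "(\<lambda>k::nat. P / (\<alpha> * real k powr \<alpha>) * A + C + 1) \<in> O(\<lambda>k. 1)" for P A C
  proof -
    have "(\<lambda>k::nat. 1 / (\<alpha> * real k powr \<alpha>)) \<in> O(\<lambda>k. 1)"
      using \<alpha> by real_asymp
    from landau_o.big.mult[OF this, of "\<lambda>_. P * A" "\<lambda>_. 1"]
    have "(\<lambda>k::nat. P / (\<alpha> * real k powr \<alpha>) * A) \<in> O(\<lambda>k. 1)"
      by simp
    then show ?thesis
      by (intro sum_in_bigo) auto
  qed
  have 3: "(\<lambda>k::nat. (1 / real k * (d * ln (6 * real k * r) + c)) powr \<gamma>)
      \<in> O(\<lambda>k. (d * ln (real k) / real k) powr \<gamma>)" for c
    using \<gamma> d \<open>0 < r\<close> by real_asymp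
  have "(\<lambda>k. excess_bound \<mu> \<Theta> \<alpha> \<delta> r k) \<in> O(\<lambda>k. (d * ln (real k) / real k) powr \<gamma>)"
    unfolding excess_bound_def d_def[symmetric] \<gamma>_def[symmetric]
    using landau_o.big.mult[OF 2 3] by (intro sum_in_bigo 1) simp
  then show ?thesis
    by (simp add: d_def \<gamma>_def)
qed

section \<open>The excess risk bound\<close>

theorem corollary4p3:
  fixes \<mu> :: "((real^'d) \<times> real) measure"
    and M :: "'w measure"
    and Z :: "nat \<Rightarrow> 'w \<Rightarrow> (real^'d) \<times> real"
    and \<Theta> :: "(real^'d) set"
    and \<phi> :: "real \<Rightarrow> real"
    and \<alpha> \<delta> r :: real
    and n :: nat
    and \<theta>_star :: "real^'d"
    and \<theta>_hat :: "'w \<Rightarrow> real^'d"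
  assumes alpha: "1 < \<alpha>" "\<alpha> < 2"
    and mu: "prob_space \<mu>" "sets \<mu> = sets borel"
    and M: "prob_space M"
    and n: "n \<ge> 1"
    and indep: "prob_space.indep_vars M (\<lambda>_. borel) Z {1..n}"
    and law: "\<And>i. i \<in> {1..n} \<Longrightarrow> distr M borel (Z i) = \<mu>"
    and phi_mono: "mono \<phi>"
    and phi_lower: "\<And>x. - ln (1 - x + \<bar>x\<bar> powr \<alpha> / \<alpha>) \<le> \<phi> x"
    and phi_upper: "\<And>x. \<phi> x \<le> ln (1 + x + \<bar>x\<bar> powr \<alpha> / \<alpha>)"
    and Theta_tb: "totally_bounded_set \<Theta>"
    and x_moment: "integrable \<mu> (\<lambda>z. norm (fst z) powr \<alpha>)"
    and risk_finite: "\<And>\<theta>. \<theta> \<in> \<Theta> \<Longrightarrow> integrable \<mu> (\<lambda>z. \<bar>residual \<theta> z\<bar> powr \<alpha>)"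
    and risk_sup_finite: "bdd_above (risk_lalpha \<mu> \<alpha> ` \<Theta>)"
    and r: "r > 0" "\<And>\<theta>. \<theta> \<in> \<Theta> \<Longrightarrow> norm \<theta> \<le> r"
    and delta: "0 < \<delta>" "\<delta> < 1 / 2"
    and theta_star: "is_arg_min (risk_l1 \<mu>) (\<lambda>\<theta>. \<theta> \<in> \<Theta>) \<theta>_star"
    and theta_hat: "\<And>\<omega>. \<omega> \<in> space M \<Longrightarrow>
      is_arg_min (emp_risk \<phi> (scale_beta \<Theta> \<alpha> \<delta> n) n (\<lambda>i. Z i \<omega>)) (\<lambda>\<theta>. \<theta> \<in> \<Theta>) (\<theta>_hat \<omega>)"
  shows "with_prob_at_least M (1 - 2 * \<delta>)
           (\<lambda>\<omega>. risk_l1 \<mu> (\<theta>_hat \<omega>) - risk_l1 \<mu> \<theta>_star \<le> excess_bound \<mu> \<Theta> \<alpha> \<delta> r n)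
       \<and> (\<lambda>k. excess_bound \<mu> \<Theta> \<alpha> \<delta> r k)
           \<in> O(\<lambda>k. (real CARD('d) * ln (real k) / real k) powr ((\<alpha> - 1) / \<alpha>))"
proof
  show "(\<lambda>k. excess_bound \<mu> \<Theta> \<alpha> \<delta> r k)
      \<in> O(\<lambda>k. (real CARD('d) * ln (real k) / real k) powr ((\<alpha> - 1) / \<alpha>))"
    using alpha(1) r(1) by (rule excess_bound_rate)
next
  interpret prob_space M by fact
  interpret mu: prob_space \<mu> by fact
  note [measurable_cong] = mu(2)
  define X where "X = (\<integral>z. norm (fst z) \<partial>\<mu>)"
  define X\<alpha> where "X\<alpha> = (\<integral>z. norm (fst z) powr \<alpha> \<partial>\<mu>)"
  define S where "S = (SUP \<theta>\<in>\<Theta>. risk_lalpha \<mu> \<alpha> \<theta>)"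
  define \<beta> where "\<beta> = scale_beta \<Theta> \<alpha> \<delta> n"
  define C where "C = 2 powr (\<alpha> - 1) / (\<alpha> * real n powr \<alpha>) * X\<alpha>
      + (2 powr (\<alpha> - 1) + 1) / \<alpha> * S + 1"
  define T where "T = 1 / real n * (real CARD('d) * ln (6 * real n * r) + ln (1 / \<delta>\<^sup>2))"
  have bound_eq: "excess_bound \<mu> \<Theta> \<alpha> \<delta> r n = 2 / real n * X + C * T powr ((\<alpha> - 1) / \<alpha>)"
    by (simp add: excess_bound_def X_def X\<alpha>_def S_def C_def T_def)
  have star: "\<theta>_star \<in> \<Theta>"
    using theta_star by (simp add: is_arg_min_def)
  have S_ge: "risk_lalpha \<mu> \<alpha> \<theta> \<le> S" if "\<theta> \<in> \<Theta>" for \<theta>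
    unfolding S_def using risk_sup_finite that by (intro cSUP_upper)
  have "0 \<le> risk_lalpha \<mu> \<alpha> \<theta>_star"
    unfolding risk_lalpha_def by simp
  with S_ge[OF star] have S_nonneg: "0 \<le> S"
    by simp
  have "0 \<le> X\<alpha>" and X: "0 \<le> X"
    by (auto simp: X\<alpha>_def X_def)
  with S_nonneg have C: "0 \<le> C"
    using alpha by (simp add: C_def)
  show "with_prob_at_least M (1 - 2 * \<delta>)
      (\<lambda>\<omega>. risk_l1 \<mu> (\<theta>_hat \<omega>) - risk_l1 \<mu> \<theta>_star \<le> excess_bound \<mu> \<Theta> \<alpha> \<delta> r n)"
  proof (cases "real n * r \<le> 1")
    \<comment> \<open>\<open>T\<close> may be negative here, so only the term \<open>(2 / n) X\<close> of the bound is used.\<close>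
    case True
    have "risk_l1 \<mu> (\<theta>_hat \<omega>) - risk_l1 \<mu> \<theta>_star \<le> excess_bound \<mu> \<Theta> \<alpha> \<delta> r n"
      if "\<omega> \<in> space M" for \<omega>
    proof -
      have hat: "\<theta>_hat \<omega> \<in> \<Theta>"
        using theta_hat[OF that] by (simp add: is_arg_min_def)
      have "risk_l1 \<mu> (\<theta>_hat \<omega>) \<le> risk_l1 \<mu> \<theta>_star + dist (\<theta>_hat \<omega>) \<theta>_star * X"
        unfolding X_def
        by (intro risk_l1_lipschitz; rule mu.integrable_of_integrable_powr[where p = \<alpha>])
          (use hat star risk_finite x_moment alpha in auto)
      also have "dist (\<theta>_hat \<omega>) \<theta>_star \<le> norm (\<theta>_hat \<omega>) + norm \<theta>_star"
        by (simp add: dist_norm norm_triangle_ineq4)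
      also have "\<dots> \<le> 2 * r"
        using r(2)[OF hat] r(2)[OF star] by simp
      also have "\<dots> \<le> 2 / real n"
        using True n by (simp add: field_simps)
      finally have "risk_l1 \<mu> (\<theta>_hat \<omega>) \<le> risk_l1 \<mu> \<theta>_star + 2 / real n * X"
        using X by (simp add: mult_right_mono)
      moreover have "0 \<le> C * T powr ((\<alpha> - 1) / \<alpha>)"
        using C by simp
      ultimately show ?thesis
        unfolding bound_eq by linarith
    qed
    then show ?thesis
      unfolding with_prob_at_least_def using delta
      by (intro bexI[of _ "space M"]) (auto simp: prob_space)
  next
    case False
    define k where "k = real (covering_number \<Theta> (1 / real n))"
    have "\<Theta> \<subseteq> cball 0 r"
      using r(2) by auto
    then obtain \<N>0 where \<N>0: "finite \<N>0" "eps_net \<Theta> (1 / real n) \<N>0"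
      and card0: "real (card \<N>0) \<le> (1 + 2 * r / (1 / real n)) ^ CARD('d)"
      using exists_small_net[of \<Theta> r "1 / real n"] n r(1) by auto
    obtain \<N> where \<N>: "finite \<N>" "eps_net \<Theta> (1 / real n) \<N>"
      and card: "card \<N> = covering_number \<Theta> (1 / real n)"
      using covering_number_attained[OF \<N>0] by blast
    have "\<N> \<noteq> {}"
      using \<N>(2) star by (auto simp: eps_net_def)
    with \<N>(1) have "1 \<le> card \<N>"
      by (simp add: card_gt_0_iff Suc_le_eq)
    then have k: "1 \<le> k"
      unfolding k_def card[symmetric] by simp
    have "k \<le> real (card \<N>0)"
      unfolding k_def using covering_number_le[OF \<N>0] by simp
    also note card0
    also have "(1 + 2 * r / (1 / real n)) ^ CARD('d) \<le> (6 * real n * r) ^ CARD('d)"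
      using False r(1) by (intro power_mono) (auto simp: algebra_simps)
    finally have k_le: "k \<le> (6 * real n * r) ^ CARD('d)" .
    have "\<delta>\<^sup>2 < 1\<^sup>2"
      using delta by (intro power_strict_mono) auto
    with k delta have arg: "1 < k / \<delta>\<^sup>2"
      by (simp add: field_simps)
    define L where "L = ln (k / \<delta>\<^sup>2)"
    have L: "0 < L"
      using arg by (simp add: L_def)
    have \<beta>_eq: "\<beta> = (L / real n) powr (1 / \<alpha>)"
      by (simp add: \<beta>_def scale_beta_def L_def k_def)
    have \<beta>: "0 < \<beta>"
      using L n by (simp add: \<beta>_eq)
    \<comment> \<open>The choice of \<open>\<beta>\<close> makes the fluctuation term equal to the order \<open>\<beta>\<^sup>\<alpha>\<^sup>-\<^sup>1\<close> of the bias.\<close>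
    have "\<beta> powr \<alpha> = L / real n"
      using L n alpha by (simp add: \<beta>_eq powr_powr)
    then have last: "L / (real n * \<beta>) = \<beta> powr (\<alpha> - 1)"
      using \<beta> by (simp add: powr_diff)
    have "L = ln k + ln (1 / \<delta>\<^sup>2)"
      using k delta by (simp add: L_def ln_div)
    also have "ln k \<le> ln ((6 * real n * r) ^ CARD('d))"
      using k k_le by simp
    also have "\<dots> = real CARD('d) * ln (6 * real n * r)"
      using n r(1) by (simp add: ln_realpow)
    finally have "L / real n \<le> T"
      using n by (simp add: T_def divide_right_mono)
    then have "(L / real n) powr ((\<alpha> - 1) / \<alpha>) \<le> T powr ((\<alpha> - 1) / \<alpha>)"
      using L n alpha by (intro powr_mono2) auto
    moreover have "\<beta> powr (\<alpha> - 1) = (L / real n) powr ((\<alpha> - 1) / \<alpha>)"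
      by (simp add: \<beta>_eq powr_powr)
    ultimately have \<beta>_le: "C * \<beta> powr (\<alpha> - 1) \<le> C * T powr ((\<alpha> - 1) / \<alpha>)"
      using C by (simp add: mult_left_mono)
    have "2 * (1 / real n) * X + \<beta> powr (\<alpha> - 1) / \<alpha> *
          (2 powr (\<alpha> - 1) * (1 / real n) powr \<alpha> * X\<alpha> + (2 powr (\<alpha> - 1) + 1) * S)
        + L / (real n * \<beta>) = 2 / real n * X + C * \<beta> powr (\<alpha> - 1)"
      unfolding last C_def using alpha n by (simp add: powr_divide field_simps)
    also have "\<dots> \<le> excess_bound \<mu> \<Theta> \<alpha> \<delta> r n"
      unfolding bound_eq using \<beta>_le by simp
    finally have final: "2 * (1 / real n) * X + \<beta> powr (\<alpha> - 1) / \<alpha> *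
          (2 powr (\<alpha> - 1) * (1 / real n) powr \<alpha> * X\<alpha> + (2 powr (\<alpha> - 1) + 1) * S)
        + L / (real n * \<beta>) \<le> excess_bound \<mu> \<Theta> \<alpha> \<delta> r n" .
    have "with_prob_at_least M (1 - 2 * \<delta>) (\<lambda>\<omega>. risk_l1 \<mu> (\<theta>_hat \<omega>) - risk_l1 \<mu> \<theta>_star
        \<le> 2 * (1 / real n) * X + \<beta> powr (\<alpha> - 1) / \<alpha> *
          (2 powr (\<alpha> - 1) * (1 / real n) powr \<alpha> * X\<alpha> + (2 powr (\<alpha> - 1) + 1) * S)
        + L / (real n * \<beta>))"
      unfolding X_def X\<alpha>_def L_def k_def card[symmetric]
      by (rule excess_risk_net[OF alpha(1) mu n indep law phi_mono phi_lower phi_upper \<beta> _ delta(1)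
            \<N> risk_finite x_moment S_ge star theta_hat[folded \<beta>_def]]) simp_all
    then show ?thesis
      unfolding with_prob_at_least_def using final by (meson order_trans)
  qed
qed

end
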